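(* For all integers $m \ge 1$ and $\ell \ge 0$, \[ r_{m,\ell} = \frac{1}{2^m\, m!} \sum_{i=0}^{m} {m+1 \brack i+1}\, r_{\ell+i}. \]
   Context: For an integer $\ell \ge 0$ let $[\ell]=\{1,\dots,\ell\}$ (so $[0]=\emptyset$). A preferential arrangement of a finite set is a ranking of its elements with ties allowed, i.e. an ordered sequence of pairwise disjoint nonempty subsets (blocks) whose union is the set; the empty set has exactly one preferential arrangement (the empty sequence). $r_\ell$ denotes the number of preferential arrangements of $[\ell]$. A barred preferential arrangement on $[\ell]$ with $m\ge 0$ bars is a preferential arrangement of $[\ell]$ together with $m$ (indistinguishable) bars placed before, between or after the blocks (no bar divides a block; several bars may be adjacent), which separate the sequence of blocks into $m+1$ consecutive, possibly empty, sections numbered $0,1,\dots,m$ from left to right. Equivalently, it is an $(m+1)$-tuple of preferential arrangements of pairwise disjoint (possibly empty) sets with union $[\ell]$. $r_{m,\ell}$ denotes the number of barred preferential arrangements on $[\ell]$ with $m$ bars; in particular $r_{0,\ell}=r_\ell$ and $r_{m,0}=1$. ${n \brack k}$ is the unsigned Stirling number of the first kind, the number of permutations of $n$ elements having exactly $k$ cycles. *)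

theory Defs
  imports Complex_Main "HOL-Library.Disjoint_Sets" "HOL-Combinatorics.Stirling"
begin

(* The blocks of a partition are pairwise distinct, so an ordered sequence of blocks is a
   duplicate-free list whose underlying set is a partition. *)
definition preferential_arrangements :: "'a set \<Rightarrow> 'a set list set" where
  "preferential_arrangements A = {bs. distinct bs \<and> partition_on A (set bs)}"

datatype 'a symbol = Bar | Block "'a set"

fun blocks_of :: "'a symbol list \<Rightarrow> 'a set list" where
  "blocks_of [] = []"
| "blocks_of (Bar # w) = blocks_of w"
| "blocks_of (Block B # w) = B # blocks_of w"

(* A barred preferential arrangement is read off from left to right as a word in blocks and
   bars; the bars carry no labels, so they are indistinguishable. *)
definition barred_preferential_arrangements :: "nat \<Rightarrow> 'a set \<Rightarrow> 'a symbol list set" where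
  "barred_preferential_arrangements m A =
     {w. count_list w Bar = m \<and> blocks_of w \<in> preferential_arrangements A}"

definition num_pa :: "nat \<Rightarrow> nat" where
  "num_pa l = card (preferential_arrangements {1..l})"

definition num_bpa :: "nat \<Rightarrow> nat \<Rightarrow> nat" where
  "num_bpa m l = card (barred_preferential_arrangements m {1..l})"

end

theory Submission
  imports Defs
begin

text \<open>
  The proof rests on the recurrence
  \<open>2 (m + 1) r(m + 1, l) = r(m, l + 1) + (m + 1) r(m, l)\<close>,
  which is obtained by counting words with one marked position.

  Let \<open>g\<close> be the number of words with \<open>m\<close> bars on an \<open>l\<close>-set in which a gap (before, between or
  after the letters) is marked, and \<open>b\<close> the number of those in which a block is marked.
  A word with \<open>k\<close> blocks has \<open>m + k + 1\<close> gaps, so \<open>g = b + (m + 1) r(m, l)\<close>.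
  Putting a bar into the marked gap gives a word with \<open>m + 1\<close> bars, one of them marked, so
  \<open>g = (m + 1) r(m + 1, l)\<close>. Adding a new element to the ground set means either
  putting it as a singleton block into a marked gap or adjoining it to a marked block, so
  \<open>r(m, l + 1) = g + b\<close>. Eliminating \<open>g\<close> and \<open>b\<close> gives the recurrence
  (\<open>barred_recurrence\<close>).

  In terms of the shift operator \<open>E\<close> on sequences, the recurrence says that
  \<open>2^m m! r(m, -)\<close> is \<open>(E + 1) (E + 2) \<cdots> (E + m)\<close> applied to \<open>r(0, -)\<close>,
  and the coefficients of this rising factorial are the Stirling numbers of the first kind.
\<close>

section \<open>Preferential arrangements as lists of disjoint blocks\<close>

text \<open>
  Since blocks are nonempty, pairwise disjointness along the list already forces the list to be
  duplicate-free. In this form membership is decomposed by the rewrite rules for appending lists.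
\<close>
lemma preferential_arrangements_iff:
  "bs \<in> preferential_arrangements A \<longleftrightarrow>
     {} \<notin> set bs \<and> \<Union> (set bs) = A \<and> sorted_wrt disjnt bs"
proof -
  have "distinct bs \<and> disjoint (set bs) \<longleftrightarrow> sorted_wrt disjnt bs" if "{} \<notin> set bs"
    using that
  proof (induction bs)
    case Nil
    show ?case by simp
  next
    case (Cons B bs)
    have "B \<noteq> {}" using Cons.prems by auto
    then have "B \<notin> set bs \<and> (\<forall>C\<in>set bs. C \<noteq> B \<longrightarrow> disjnt B C) \<longleftrightarrow> (\<forall>C\<in>set bs. disjnt B C)"
      by (auto simp: disjnt_def)
    moreover have "disjoint (insert B (set bs)) \<longleftrightarrow>
        (\<forall>C\<in>set bs. C \<noteq> B \<longrightarrow> disjnt B C) \<and> disjoint (set bs)"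
      by (auto simp: pairwise_insert disjnt_sym)
    ultimately show ?case using Cons by auto
  qed
  then show ?thesis
    by (auto simp: preferential_arrangements_def partition_on_def)
qed

text \<open>
  Removing one block leaves an arrangement of the remaining elements. This reduces both ways of
  adding a new element \<open>x\<close> below to an identity between set differences.
\<close>
lemma remove_block:
  "bs @ B # cs \<in> preferential_arrangements A \<longleftrightarrow>
    B \<noteq> {} \<and> B \<subseteq> A \<and> bs @ cs \<in> preferential_arrangements (A - B)"
proof -
  let ?U = "\<Union> (set (bs @ cs))"
  have "sorted_wrt disjnt (bs @ B # cs) \<longleftrightarrow> sorted_wrt disjnt (bs @ cs) \<and> disjnt B ?U"
    by (auto simp: sorted_wrt_append disjnt_Union2 disjnt_sym)
  moreover have "\<Union> (set (bs @ B # cs)) = B \<union> ?U" by auto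
  moreover have "disjnt B ?U \<and> B \<union> ?U = A \<longleftrightarrow> B \<subseteq> A \<and> ?U = A - B"
    unfolding disjnt_def by blast
  moreover have "{} \<notin> set (bs @ B # cs) \<longleftrightarrow> B \<noteq> {} \<and> {} \<notin> set (bs @ cs)" by auto
  ultimately show ?thesis unfolding preferential_arrangements_iff by metis
qed

lemma insert_singleton_block:
  assumes "x \<notin> A"
  shows "bs @ {x} # cs \<in> preferential_arrangements (insert x A) \<longleftrightarrow>
    bs @ cs \<in> preferential_arrangements A"
  using assms by (simp add: remove_block)

lemma adjoin_to_block:
  assumes "x \<notin> A" "x \<notin> B" "B \<noteq> {}"
  shows "bs @ insert x B # cs \<in> preferential_arrangements (insert x A) \<longleftrightarrow>
    bs @ B # cs \<in> preferential_arrangements A"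
proof -
  have "insert x A - insert x B = A - B" "insert x B \<subseteq> insert x A \<longleftrightarrow> B \<subseteq> A"
    using assms by auto
  then show ?thesis using assms by (simp add: remove_block)
qed

section \<open>Words in blocks and bars\<close>

lemma blocks_of_append [simp]: "blocks_of (u @ v) = blocks_of u @ blocks_of v"
  by (induction u rule: blocks_of.induct) auto

lemma set_blocks_of: "set (blocks_of w) = {B. Block B \<in> set w}"
  by (induction w rule: blocks_of.induct) auto

lemma length_eq_bars_plus_blocks: "length w = count_list w Bar + length (blocks_of w)"
  by (induction w rule: blocks_of.induct) auto

lemma barred_iff:
  "w \<in> barred_preferential_arrangements m A \<longleftrightarrow>
     count_list w Bar = m \<and> blocks_of w \<in> preferential_arrangements A"
  by (simp add: barred_preferential_arrangements_def)

lemma Block_subset_of_barred: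
  assumes "w \<in> barred_preferential_arrangements m A" "Block B \<in> set w"
  shows "B \<subseteq> A" "B \<noteq> {}"
  using assms by (auto simp: barred_iff preferential_arrangements_iff set_blocks_of)

lemma finite_barred:
  assumes "finite A"
  shows "finite (barred_preferential_arrangements m A)"
proof (rule finite_subset)
  let ?L = "insert Bar (Block ` Pow A)"
  show "barred_preferential_arrangements m A \<subseteq>
      {w. set w \<subseteq> ?L \<and> length w \<le> m + card (Pow A)}"
  proof
    fix w assume w: "w \<in> barred_preferential_arrangements m A"
    have "set w \<subseteq> ?L"
    proof
      fix s assume s: "s \<in> set w"
      show "s \<in> ?L"
      proof (cases s)
        case (Block B)
        then show ?thesis using s Block_subset_of_barred(1)[OF w] by simp
      qed simp
    qed
    moreover have "length (blocks_of w) \<le> card (Pow A)"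
    proof -
      have "distinct (blocks_of w)"
        using w by (simp add: barred_iff preferential_arrangements_def)
      moreover have "set (blocks_of w) \<subseteq> Pow A"
        using Block_subset_of_barred(1)[OF w] by (auto simp: set_blocks_of)
      ultimately show ?thesis
        using assms by (metis card_mono distinct_card finite_Pow_iff)
    qed
    ultimately show "w \<in> {w. set w \<subseteq> ?L \<and> length w \<le> m + card (Pow A)}"
      using w length_eq_bars_plus_blocks[of w] by (simp add: barred_iff)
  qed
  show "finite {w. set w \<subseteq> ?L \<and> length w \<le> m + card (Pow A)}"
    by (rule finite_lists_length_le) (use assms in simp)
qed

lemma card_barred_0:
  "card (barred_preferential_arrangements 0 A) = card (preferential_arrangements A)"
proof -
  have blocks: "blocks_of (map Block bs) = bs" "count_list (map Block bs) Bar = 0"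
    for bs :: "'a set list"
    by (induction bs) auto
  have "map Block (blocks_of w) = w" if "count_list w Bar = 0" for w :: "'a symbol list"
    using that by (induction w rule: blocks_of.induct) auto
  then have "bij_betw blocks_of (barred_preferential_arrangements 0 A) (preferential_arrangements A)"
    by (intro bij_betwI[where g = "map Block"]) (auto simp: barred_iff blocks)
  then show ?thesis by (rule bij_betw_same_card)
qed

section \<open>Counting words with a marked position\<close>

text \<open>
  A word with a marked position is represented by the part to the left and the part to the right of
  the mark, together with the marked block if a block is marked. The next lemmas count the ways to
  mark one given word.
\<close>

lemma card_gaps:
  "finite {p. fst p @ snd p = w} \<and> card {p. fst p @ snd p = w} = length w + 1"
proof -
  have "p \<in> (\<lambda>i. (take i w, drop i w)) ` {..length w}" if "fst p @ snd p = w" for p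
    using that by (intro image_eqI[where x = "length (fst p)"]) auto
  then have "{p. fst p @ snd p = w} = (\<lambda>i. (take i w, drop i w)) ` {..length w}"
    by auto
  moreover have "inj_on (\<lambda>i. (take i w, drop i w)) {..length w}"
    by (rule inj_on_inverseI[where g = "\<lambda>p. length (fst p)"]) simp
  ultimately show ?thesis by (simp add: card_image)
qed

lemma card_occurrences:
  "finite {p. fst p @ s # snd p = w} \<and> card {p. fst p @ s # snd p = w} = count_list w s"
proof (induction w)
  case Nil
  show ?case by simp
next
  case (Cons t w)
  let ?shift = "\<lambda>p. (t # fst p, snd p)"
  have split: "{p. fst p @ s # snd p = t # w} =
      (if s = t then {([], w)} else {}) \<union> ?shift ` {p. fst p @ s # snd p = w}"
    by (auto simp: Cons_eq_append_conv append_eq_Cons_conv image_iff)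
  have "inj_on ?shift {p. fst p @ s # snd p = w}"
    by (auto simp: inj_on_def prod_eq_iff)
  moreover have "([], w) \<notin> ?shift ` {p. fst p @ s # snd p = w}" by auto
  ultimately show ?case
    unfolding split using Cons.IH by (auto simp: card_image)
qed

lemma card_marked_blocks:
  "finite {(u, B, v). u @ Block B # v = w} \<and>
   card {(u, B, v). u @ Block B # v = w} = length (blocks_of w)"
proof (induction w rule: blocks_of.induct)
  case 1
  show ?case by simp
next
  case (2 w)
  let ?shift = "\<lambda>(u, B, v). (Bar # u, B, v)"
  have split: "{(u, B, v). u @ Block B # v = Bar # w} = ?shift ` {(u, B, v). u @ Block B # v = w}"
    by (auto simp: append_eq_Cons_conv image_iff)
  have "inj_on ?shift {(u, B, v). u @ Block B # v = w}" by (auto simp: inj_on_def)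
  then show ?case unfolding split using 2 by (simp add: card_image)
next
  case (3 C w)
  let ?shift = "\<lambda>(u, B, v). (Block C # u, B, v)"
  have split: "{(u, B, v). u @ Block B # v = Block C # w} =
      insert ([], C, w) (?shift ` {(u, B, v). u @ Block B # v = w})"
    by (auto simp: append_eq_Cons_conv image_iff)
  have "inj_on ?shift {(u, B, v). u @ Block B # v = w}" by (auto simp: inj_on_def)
  moreover have "([], C, w) \<notin> ?shift ` {(u, B, v). u @ Block B # v = w}" by auto
  ultimately show ?case unfolding split using 3 by (simp add: card_image)
qed

lemma card_vimage_eq_sum_fibres:
  assumes "finite W" "\<And>w. w \<in> W \<Longrightarrow> finite {p. f p = w}"
  shows "card {p. f p \<in> W} = (\<Sum>w\<in>W. card {p. f p = w})"
proof -
  have eq: "{p. f p \<in> W} = (\<Union>w\<in>W. {p. f p = w})" by auto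
  show "card {p. f p \<in> W} = (\<Sum>w\<in>W. card {p. f p = w})"
    unfolding eq by (rule card_UN_disjoint) (use assms in auto)
qed

section \<open>The recurrence in the number of bars\<close>

text \<open>
  A marked gap can be read as one additional bar that is marked, and every word with \<open>m + 1\<close>
  bars has \<open>m + 1\<close> bars to mark.
\<close>
lemma marked_bar_count:
  assumes "finite A"
  shows "Suc m * card (barred_preferential_arrangements (Suc m) A) =
    card {p. fst p @ snd p \<in> barred_preferential_arrangements m A}"
proof -
  let ?W = "barred_preferential_arrangements (Suc m) A"
  have "{p. fst p @ snd p \<in> barred_preferential_arrangements m A} =
      {p. fst p @ Bar # snd p \<in> ?W}"
    by (simp add: barred_iff)
  also have "card \<dots> = (\<Sum>w\<in>?W. card {p. fst p @ Bar # snd p = w})"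
    by (rule card_vimage_eq_sum_fibres) (use assms in \<open>auto simp: finite_barred card_occurrences\<close>)
  also have "\<dots> = (\<Sum>w\<in>?W. Suc m)"
    by (rule sum.cong) (auto simp: card_occurrences barred_iff)
  finally show ?thesis by simp
qed

text \<open>
  A word with \<open>m\<close> bars has \<open>m + 1\<close> more gaps than blocks.
\<close>
lemma marked_gap_count:
  assumes "finite A"
  shows "card {p. fst p @ snd p \<in> barred_preferential_arrangements m A} =
    card {(u, B, v). u @ Block B # v \<in> barred_preferential_arrangements m A} +
      Suc m * card (barred_preferential_arrangements m A)"
proof -
  let ?W = "barred_preferential_arrangements m A"
  let ?f = "\<lambda>(u, B, v). u @ Block B # v"
  have fibre: "{t. ?f t = w} = {(u, B, v). u @ Block B # v = w}" for w :: "'a symbol list"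
    by auto
  have "card {p. fst p @ snd p \<in> ?W} = (\<Sum>w\<in>?W. card {p. fst p @ snd p = w})"
    by (rule card_vimage_eq_sum_fibres) (use assms in \<open>auto simp: finite_barred card_gaps\<close>)
  also have "\<dots> = (\<Sum>w\<in>?W. length (blocks_of w) + Suc m)"
    by (rule sum.cong) (auto simp: card_gaps barred_iff length_eq_bars_plus_blocks)
  also have "\<dots> = (\<Sum>w\<in>?W. card {t. ?f t = w}) + Suc m * card ?W"
    unfolding fibre sum.distrib by (simp add: card_marked_blocks)
  also have "(\<Sum>w\<in>?W. card {t. ?f t = w}) = card {t. ?f t \<in> ?W}"
    by (rule card_vimage_eq_sum_fibres[symmetric])
      (use assms in \<open>simp_all only: fibre finite_barred card_marked_blocks\<close>)
  also have "{t. ?f t \<in> ?W} = {(u, B, v). u @ Block B # v \<in> ?W}" by auto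
  finally show ?thesis .
qed

text \<open>
  The block containing the new element \<open>x\<close> is either \<open>{x}\<close>, whose removal leaves a marked
  gap, or it is larger, and removing \<open>x\<close> from it leaves a marked block.
\<close>
lemma new_element_count:
  assumes "finite A" "x \<notin> A"
  shows "card (barred_preferential_arrangements m (insert x A)) =
    card {p. fst p @ snd p \<in> barred_preferential_arrangements m A} +
    card {(u, B, v). u @ Block B # v \<in> barred_preferential_arrangements m A}"
proof -
  let ?W = "barred_preferential_arrangements m A"
  let ?W' = "barred_preferential_arrangements m (insert x A)"
  let ?P = "{p. fst p @ snd p \<in> ?W}"
  let ?R = "{(u, B, v). u @ Block B # v \<in> ?W}"
  let ?f = "\<lambda>p. fst p @ Block {x} # snd p"
  let ?g = "\<lambda>(u, B, v). u @ Block (insert x B) # v"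
  have no_x: "x \<notin> B" if "w \<in> ?W" "Block B \<in> set w" for w B
    using Block_subset_of_barred(1)[OF that] assms(2) by auto
  have singleton: "u @ Block {x} # v \<in> ?W' \<longleftrightarrow> u @ v \<in> ?W" for u v
    using insert_singleton_block[OF assms(2)] by (simp add: barred_iff)
  have adjoin: "u @ Block (insert x B) # v \<in> ?W' \<longleftrightarrow> u @ Block B # v \<in> ?W"
    if "x \<notin> B" "B \<noteq> {}" for u B v
    using adjoin_to_block[OF assms(2) that] by (simp add: barred_iff)
  have R: "x \<notin> B" "B \<noteq> {}" "\<And>C. Block (insert x C) \<notin> set u" "\<And>C. Block (insert x C) \<notin> set v"
    if "u @ Block B # v \<in> ?W" for u B v
    using no_x[OF that] Block_subset_of_barred(2)[OF that] by auto

  have "?W' = ?f ` ?P \<union> ?g ` ?R"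
  proof (intro equalityI subsetI)
    fix w assume w: "w \<in> ?W'"
    then have "x \<in> \<Union> (set (blocks_of w))"
      by (simp add: barred_iff preferential_arrangements_iff)
    then obtain C where C: "Block C \<in> set w" "x \<in> C"
      by (auto simp: set_blocks_of)
    then obtain u v where w_eq: "w = u @ Block C # v"
      by (meson split_list)
    show "w \<in> ?f ` ?P \<union> ?g ` ?R"
    proof (cases "C = {x}")
      case True
      then have "(u, v) \<in> ?P" using w w_eq singleton by simp
      moreover have "w = ?f (u, v)" using True w_eq by simp
      ultimately show ?thesis by blast
    next
      case False
      have C_eq: "insert x (C - {x}) = C" using C(2) by blast
      then have "(u, C - {x}, v) \<in> ?R"
        using w w_eq adjoin[of "C - {x}" u v] False by auto
      moreover have "w = ?g (u, C - {x}, v)" using C_eq w_eq by simp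
      ultimately show ?thesis by blast
    qed
  next
    fix w assume "w \<in> ?f ` ?P \<union> ?g ` ?R"
    then show "w \<in> ?W'" using singleton adjoin R(1,2) by auto
  qed
  moreover have "?f ` ?P \<inter> ?g ` ?R = {}"
  proof -
    have "u @ Block {x} # v \<noteq> u' @ Block (insert x B) # v'"
      if "u' @ Block B # v' \<in> ?W" for u v u' B v'
    proof
      assume "u @ Block {x} # v = u' @ Block (insert x B) # v'"
      then have "Block {x} \<in> set (u' @ Block (insert x B) # v')"
        by (metis in_set_conv_decomp)
      then show False using R[OF that] by auto
    qed
    then show ?thesis by auto
  qed
  moreover have "inj_on ?f ?P"
  proof (rule inj_onI)
    fix p q assume "p \<in> ?P" "q \<in> ?P" and eq: "?f p = ?f q"
    then have "Block {x} \<notin> set (fst p)" "Block {x} \<notin> set (snd p)"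
      using no_x[of "fst p @ snd p" "{x}"] by auto
    then show "p = q"
      using eq by (auto simp: append_Cons_eq_iff prod_eq_iff)
  qed
  moreover have "inj_on ?g ?R"
  proof -
    have "u = u' \<and> B = B' \<and> v = v'"
      if uv: "u @ Block B # v \<in> ?W" "u' @ Block B' # v' \<in> ?W"
        and eq: "u @ Block (insert x B) # v = u' @ Block (insert x B') # v'"
      for u B v u' B' v'
    proof -
      have "Block (insert x B) \<in> set (u' @ Block (insert x B') # v')"
        using eq by (metis in_set_conv_decomp)
      then have "insert x B = insert x B'" using R(3,4)[OF uv(2)] by auto
      then have "B = B'" using R(1)[OF uv(1)] R(1)[OF uv(2)] by (simp add: insert_ident)
      then show ?thesis
        using eq R(3,4)[OF uv(1)] by (auto simp: append_Cons_eq_iff)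
    qed
    then show ?thesis unfolding inj_on_def by auto
  qed
  moreover have "finite ?W'" using assms(1) by (simp add: finite_barred)
  ultimately show ?thesis
    by (metis (no_types, lifting) card_Un_disjoint card_image finite_Un)
qed

lemma barred_recurrence:
  assumes "finite A" "x \<notin> A"
  shows "2 * Suc m * card (barred_preferential_arrangements (Suc m) A) =
    card (barred_preferential_arrangements m (insert x A)) +
      Suc m * card (barred_preferential_arrangements m A)"
  using marked_bar_count[OF assms(1), of m] marked_gap_count[OF assms(1), of m]
    new_element_count[OF assms, of m]
  by simp

lemma num_bpa_Suc:
  "2 * Suc m * num_bpa (Suc m) l = num_bpa m (Suc l) + Suc m * num_bpa m l"
  using barred_recurrence[of "{1..l}" "Suc l" m]
  by (simp add: num_bpa_def atLeastAtMostSuc_conv)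

section \<open>Stirling numbers as the coefficients of the iterated recurrence\<close>

text \<open>
  Multiplying a polynomial in the shift operator by \<open>E + (m + 1)\<close> turns the coefficients
  \<open>stirling (m + 1) (i + 1)\<close> into \<open>stirling (m + 2) (i + 1)\<close>.
\<close>
lemma sum_stirling_Suc:
  fixes f :: "nat \<Rightarrow> nat"
  shows "(\<Sum>i\<le>Suc m. stirling (Suc (Suc m)) (Suc i) * f i) =
    (\<Sum>i\<le>m. stirling (Suc m) (Suc i) * f (Suc i)) +
      Suc m * (\<Sum>i\<le>m. stirling (Suc m) (Suc i) * f i)"
proof -
  have "(\<Sum>i\<le>Suc m. stirling (Suc (Suc m)) (Suc i) * f i) =
      (\<Sum>i\<le>Suc m. Suc m * (stirling (Suc m) (Suc i) * f i)) +
      (\<Sum>i\<le>Suc m. stirling (Suc m) i * f i)"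
    unfolding sum.distrib[symmetric] by (rule sum.cong) (auto simp: algebra_simps)
  also have "(\<Sum>i\<le>Suc m. Suc m * (stirling (Suc m) (Suc i) * f i)) =
      Suc m * (\<Sum>i\<le>m. stirling (Suc m) (Suc i) * f i)"
    by (simp add: sum_distrib_left del: stirling.simps)
  also have "(\<Sum>i\<le>Suc m. stirling (Suc m) i * f i) =
      (\<Sum>i\<le>m. stirling (Suc m) (Suc i) * f (Suc i))"
    by (simp only: sum.atMost_Suc_shift stirling.simps(2)) simp
  finally show ?thesis by simp
qed

lemma num_bpa_eq_sum_stirling:
  "2 ^ m * fact m * num_bpa m l = (\<Sum>i\<le>m. stirling (Suc m) (Suc i) * num_pa (l + i))"
proof (induction m arbitrary: l)
  case 0
  show ?case by (simp add: num_bpa_def num_pa_def card_barred_0)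
next
  case (Suc m)
  have "2 ^ Suc m * fact (Suc m) * num_bpa (Suc m) l =
      2 ^ m * fact m * (2 * Suc m * num_bpa (Suc m) l)"
    by (simp add: algebra_simps)
  also have "\<dots> = 2 ^ m * fact m * num_bpa m (Suc l) + Suc m * (2 ^ m * fact m * num_bpa m l)"
    unfolding num_bpa_Suc by (simp add: algebra_simps)
  also have "\<dots> = (\<Sum>i\<le>Suc m. stirling (Suc (Suc m)) (Suc i) * num_pa (l + i))"
    unfolding Suc.IH sum_stirling_Suc[of m "\<lambda>i. num_pa (l + i)"] by simp
  finally show ?case .
qed

theorem theorem2p2:
  fixes m l :: nat
  assumes "m \<ge> 1"
  shows "real (num_bpa m l) =
    1 / (2 ^ m * fact m) * (\<Sum>i=0..m. real (stirling (m + 1) (i + 1)) * real (num_pa (l + i)))"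
proof -
  have "2 ^ m * fact m * real (num_bpa m l) = real (2 ^ m * fact m * num_bpa m l)"
    by simp
  also have "\<dots> = (\<Sum>i=0..m. real (stirling (m + 1) (i + 1)) * real (num_pa (l + i)))"
    unfolding num_bpa_eq_sum_stirling by (simp add: atLeast0AtMost del: stirling.simps)
  finally show ?thesis by (simp add: field_simps del: stirling.simps)
qed

end
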